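(* For all integers $n \geq k \geq 6$, $$\left(1 + \frac{1}{2k-2}\right)n - 2 < \mathrm{ssat}(n,C_k) < \left(1 + \frac{1}{2k-10}\right)n + k-1.$$
   Context: All graphs are finite and simple. $C_k$ denotes the cycle of length $k$ (on $k$ vertices). A graph $G$ is $H$-semisaturated if for every edge $e$ of the complement $\overline{G}$ the graph $G+e$ contains more copies of $H$ (as not necessarily induced subgraphs) than $G$ does; $G$ itself is allowed to contain copies of $H$. $\mathrm{ssat}(n,H)$ denotes the minimum number of edges of an $H$-semisaturated graph on $n$ vertices. *)

theory Defs
  imports Complex_Main
begin

text \<open>An undirected graph is a pair of a vertex set and a set of edges, an edge being
  the two-element set of its ends.\<close>

type_synonym 'a ugraph = "'a set \<times> 'a set set"

abbreviation verts :: "'a ugraph \<Rightarrow> 'a set" where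
  "verts G \<equiv> fst G"

abbreviation edges :: "'a ugraph \<Rightarrow> 'a set set" where
  "edges G \<equiv> snd G"

definition finite_simple_graph :: "'a ugraph \<Rightarrow> bool" where
  "finite_simple_graph G \<longleftrightarrow>
     finite (verts G) \<and> (\<forall>e\<in>edges G. e \<subseteq> verts G \<and> card e = 2)"

definition compl_edges :: "'a ugraph \<Rightarrow> 'a set set" where
  "compl_edges G = {e. e \<subseteq> verts G \<and> card e = 2 \<and> e \<notin> edges G}"

definition add_edge :: "'a ugraph \<Rightarrow> 'a set \<Rightarrow> 'a ugraph" where
  "add_edge G e = (verts G, insert e (edges G))"

text \<open>Subgraphs are not necessarily induced.\<close>

definition subgraph :: "'a ugraph \<Rightarrow> 'a ugraph \<Rightarrow> bool" where
  "subgraph S G \<longleftrightarrow>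
     finite_simple_graph S \<and> verts S \<subseteq> verts G \<and> edges S \<subseteq> edges G"

definition graph_iso :: "'a ugraph \<Rightarrow> 'b ugraph \<Rightarrow> bool" where
  "graph_iso G H \<longleftrightarrow>
     (\<exists>f. bij_betw f (verts G) (verts H) \<and>
          (\<forall>u\<in>verts G. \<forall>v\<in>verts G. {u, v} \<in> edges G \<longleftrightarrow> {f u, f v} \<in> edges H))"

definition copies :: "'b ugraph \<Rightarrow> 'a ugraph \<Rightarrow> 'a ugraph set" where
  "copies H G = {S. subgraph S G \<and> graph_iso S H}"

definition semisaturated :: "'b ugraph \<Rightarrow> 'a ugraph \<Rightarrow> bool" where
  "semisaturated H G \<longleftrightarrow>
     (\<forall>e\<in>compl_edges G. card (copies H (add_edge G e)) > card (copies H G))"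

text \<open>Semisaturation is invariant under isomorphism, so it is enough to let the vertices be
  natural numbers. The minimum exists, since a complete graph is semisaturated.\<close>

definition ssat :: "nat \<Rightarrow> 'b ugraph \<Rightarrow> nat" where
  "ssat n H =
     (LEAST m. \<exists>G :: nat ugraph. finite_simple_graph G \<and> card (verts G) = n \<and>
        semisaturated H G \<and> card (edges G) = m)"

text \<open>This is the cycle of length \<open>k\<close> for \<open>k \<ge> 3\<close> only.\<close>

definition cycle_graph :: "nat \<Rightarrow> nat ugraph" where
  "cycle_graph k = ({..<k}, (\<lambda>i. {i, Suc i mod k}) ` {..<k})"

end

theory Submission
  imports Defs "HOL-Library.Countable"
begin

text \<open>A graph is semisaturated for the cycle of length \<open>k\<close> iff any two non-adjacent vertices
  are joined by a path on \<open>k\<close> vertices (\<open>semisaturated_cycle_iff\<close>), so both bounds are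
  statements about paths.

  Lower bound. Two pendant vertices never share their neighbour, and the neighbour of a pendant
  vertex is not pendant, because some vertices would be joined by too short a path only, or by none.
  So the non-pendant vertices form a core, and the
  graph is the core with at most one pendant vertex hung on each of its vertices. Give a core
  vertex weight 2 if it carries a pendant vertex and weight 1 otherwise; the total weight is then
  the number of vertices of the graph. The core is built up from one vertex. As long as a set
  \<open>S\<close> is not the whole core, there is an ear or a lollipop (a path that ends by meeting itself)
  that starts in \<open>S\<close> and runs through new core vertices of total weight at most
  \<open>2 * k - 2\<close> (\<open>extendable_of_proper_subset\<close>): a path of \<open>k\<close> or \<open>k - 1\<close> vertices supplied by
  semisaturation closes up a short cycle. Each such step brings more edges than vertices.
  A single vertex has weight at most 2, so at least \<open>(n - 2) / (2 * k - 2)\<close> steps are needed, and each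
  raises the number of edges minus the number of vertices by at least one (\<open>card_V_le\<close>).

  Upper bound. Take a wheel on \<open>k\<close> vertices and attach ears, each a path of at most \<open>k - 5\<close>
  new vertices from the centre to one fixed rim vertex, with pendant vertices hung on the vertices
  of the ears. The wheel contains paths of all orders from 2 to \<open>k\<close> from its centre to any rim
  vertex, so it can adjust the length of a path that leaves one ear through the centre and
  enters another one through the rim (\<open>linked_nonadjacent\<close>). A full ear
  with its pendant vertices adds \<open>2 * k - 10\<close> vertices and only one edge more than that.\<close>

section \<open>Paths and copies of cycles\<close>

definition path_between :: "'a set set \<Rightarrow> 'a \<Rightarrow> 'a list \<Rightarrow> 'a \<Rightarrow> bool" where
  "path_between E x p y \<longleftrightarrow> p \<noteq> [] \<and> hd p = x \<and> last p = y \<and> distinct p \<and>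
     successively (\<lambda>u v. {u, v} \<in> E) p"

lemma path_between_rev: "path_between E x p y \<Longrightarrow> path_between E y (rev p) x"
  by (auto simp: path_between_def hd_rev last_rev insert_commute)

lemma path_between_join:
  assumes "path_between E x p y" "path_between E x' q y'" "{y, x'} \<in> E" "set p \<inter> set q = {}"
  shows "path_between E x (p @ q) y'"
  using assms by (auto simp: path_between_def successively_append_iff)

lemma path_between_Cons:
  assumes "path_between E x p y" "{v, x} \<in> E" "v \<notin> set p"
  shows "path_between E v (v # p) y"
  using assms by (cases p) (auto simp: path_between_def)

lemma path_between_suffix:
  assumes "path_between E x (as @ v # bs) y"
  shows "path_between E v (v # bs) y"
  using assms by (auto simp: path_between_def successively_append_iff)

lemma path_between_verts:
  assumes "path_between E x p y" "x \<noteq> y" "\<And>e. e \<in> E \<Longrightarrow> e \<subseteq> V"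
  shows "set p \<subseteq> V"
proof
  fix z assume "z \<in> set p"
  then obtain as bs where p: "p = as @ z # bs"
    by (meson split_list)
  show "z \<in> V"
  proof (cases "bs = []")
    case True
    then have "as \<noteq> []"
      using assms(1,2) p by (cases as) (auto simp: path_between_def)
    then have "{last as, z} \<in> E"
      using assms(1) p by (auto simp: path_between_def successively_append_iff)
    then show ?thesis using assms(3) by blast
  next
    case False
    then have "{z, hd bs} \<in> E"
      using assms(1) p by (cases bs) (auto simp: path_between_def successively_append_iff)
    then show ?thesis using assms(3) by blast
  qed
qed

lemma path_between_map:
  assumes "path_between E x p y" "inj f"
  shows "path_between ((`) f ` E) (f x) (map f p) (f y)"
proof -
  have "{f u, f v} \<in> (`) f ` E" if "{u, v} \<in> E" for u v
    using imageI[OF that, of "(`) f"] by simp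
  then have "successively (\<lambda>u v. {f u, f v} \<in> (`) f ` E) p"
    using successively_mono[of "\<lambda>u v. {u, v} \<in> E" p] assms(1)
    by (simp add: path_between_def)
  with assms show ?thesis
    by (auto simp: path_between_def hd_map last_map distinct_map successively_map
        intro: inj_on_subset)
qed

lemma finite_simple_graph_cycle:
  assumes "2 \<le> k"
  shows "finite_simple_graph (cycle_graph k)"
proof -
  have "i \<noteq> Suc i mod k" if "i < k" for i
    using that assms by (cases "Suc i = k") auto
  then show ?thesis
    using assms by (auto simp: finite_simple_graph_def cycle_graph_def card_2_iff)
qed

text \<open>An isomorphism from \<open>S\<close> to \<open>H\<close> is inverted to an injection of \<open>H\<close> into \<open>G\<close>, which is the
  form in which the vertices of a cycle can be listed in order.\<close>
lemma mem_copies_iff: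
  assumes H: "finite_simple_graph H" and G: "finite_simple_graph G"
  shows "S \<in> copies H G \<longleftrightarrow>
    (\<exists>g. inj_on g (verts H) \<and> S = (g ` verts H, (`) g ` edges H) \<and>
         g ` verts H \<subseteq> verts G \<and> (`) g ` edges H \<subseteq> edges G)"
proof
  assume "S \<in> copies H G"
  then obtain f where sub: "subgraph S G" and f: "bij_betw f (verts S) (verts H)"
    and fe: "\<And>u v. u \<in> verts S \<Longrightarrow> v \<in> verts S \<Longrightarrow> {u, v} \<in> edges S \<longleftrightarrow> {f u, f v} \<in> edges H"
    by (auto simp: copies_def graph_iso_def)
  define g where "g = inv_into (verts S) f"
  have g: "bij_betw g (verts H) (verts S)"
    using f by (simp add: g_def bij_betw_inv_into)
  have fg: "f (g v) = v" if "v \<in> verts H" for v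
    using f that by (simp add: g_def bij_betw_inv_into_right)
  have gf: "g (f v) = v" if "v \<in> verts S" for v
    using f that by (simp add: g_def bij_betw_inv_into_left)
  have gV: "g ` verts H = verts S" using g by (simp add: bij_betw_def)
  have "(`) g ` edges H = edges S"
  proof (intro set_eqI iffI)
    fix e assume "e \<in> (`) g ` edges H"
    then obtain a where a: "a \<in> edges H" "e = g ` a" by auto
    then obtain x y where xy: "a = {x, y}" "x \<in> verts H" "y \<in> verts H"
      using H unfolding finite_simple_graph_def card_2_iff by (metis insert_subset)
    then show "e \<in> edges S"
      using fe[of "g x" "g y"] a gV fg by auto
  next
    fix e assume e: "e \<in> edges S"
    then obtain x y where xy: "e = {x, y}" "x \<in> verts S" "y \<in> verts S"
      using sub unfolding subgraph_def finite_simple_graph_def card_2_iff by (metis insert_subset)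
    then have "{f x, f y} \<in> edges H" using fe e by auto
    moreover have "e = g ` {f x, f y}" using xy gf by auto
    ultimately show "e \<in> (`) g ` edges H" by blast
  qed
  then have "S = (g ` verts H, (`) g ` edges H)"
    using gV by (simp add: prod_eq_iff)
  then show "\<exists>g. inj_on g (verts H) \<and> S = (g ` verts H, (`) g ` edges H) \<and>
         g ` verts H \<subseteq> verts G \<and> (`) g ` edges H \<subseteq> edges G"
    using g sub by (intro exI[of _ g]) (auto simp: bij_betw_def subgraph_def)
next
  assume "\<exists>g. inj_on g (verts H) \<and> S = (g ` verts H, (`) g ` edges H) \<and>
         g ` verts H \<subseteq> verts G \<and> (`) g ` edges H \<subseteq> edges G"
  then obtain g where g: "inj_on g (verts H)" and S: "S = (g ` verts H, (`) g ` edges H)"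
    and sub: "g ` verts H \<subseteq> verts G" "(`) g ` edges H \<subseteq> edges G" by blast
  have eV: "e \<subseteq> verts H" if "e \<in> edges H" for e
    using H that by (auto simp: finite_simple_graph_def)
  have "finite_simple_graph S"
    using H g eV unfolding S finite_simple_graph_def
    by (auto simp: card_image inj_on_subset)
  moreover have "graph_iso S H"
    unfolding graph_iso_def
  proof (intro exI conjI ballI)
    let ?f = "inv_into (verts H) g"
    show "bij_betw ?f (verts S) (verts H)"
      unfolding S using g by (simp add: bij_betw_inv_into inj_on_imp_bij_betw)
    fix u v assume "u \<in> verts S" "v \<in> verts S"
    then obtain x y where xy: "u = g x" "v = g y" "x \<in> verts H" "y \<in> verts H"
      by (auto simp: S)
    have "{g x, g y} = g ` {x, y}" by simp
    then have "{u, v} \<in> edges S \<longleftrightarrow> (\<exists>a\<in>edges H. g ` {x, y} = g ` a)"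
      using xy by (auto simp: S image_iff)
    also have "\<dots> \<longleftrightarrow> {x, y} \<in> edges H"
      using inj_on_image_eq_iff[OF g] eV xy by (metis empty_subsetI insert_subset)
    finally show "{u, v} \<in> edges S \<longleftrightarrow> {?f u, ?f v} \<in> edges H"
      using xy g by simp
  qed
  ultimately show "S \<in> copies H G"
    using sub by (auto simp: copies_def subgraph_def S)
qed

lemma finite_copies:
  assumes "finite_simple_graph G"
  shows "finite (copies H G)"
proof (rule finite_subset)
  show "copies H G \<subseteq> Pow (verts G) \<times> Pow (edges G)"
    by (auto simp: copies_def subgraph_def)
  have "edges G \<subseteq> Pow (verts G)"
    using assms by (auto simp: finite_simple_graph_def)
  then show "finite (Pow (verts G) \<times> Pow (edges G))"
    using assms by (auto simp: finite_simple_graph_def intro: finite_subset)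
qed

lemma image_edges_cycle_graph:
  "(`) g ` edges (cycle_graph k) = (\<lambda>i. {g i, g (Suc i mod k)}) ` {..<k}"
  by (simp add: cycle_graph_def image_image)

text \<open>A cycle of \<open>E\<close> plus one edge that does not lie in \<open>E\<close> must use the additional edge. Walking once
  round the cycle, starting at one end of that edge, gives a path inside \<open>E\<close> to the other end.\<close>
lemma path_from_cycle_through_edge:
  assumes k: "3 \<le> k" and g: "inj_on g {..<k}"
    and E: "(`) g ` edges (cycle_graph k) \<subseteq> insert {x, y} E"
    and not_E: "\<not> (`) g ` edges (cycle_graph k) \<subseteq> E"
  shows "\<exists>p. path_between E x p y \<and> length p = k"
proof -
  have adj: "{g i, g (Suc i mod k)} \<in> insert {x, y} E" if "i < k" for i
    using E that unfolding image_edges_cycle_graph by blast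
  obtain i where i: "i < k" "{g i, g (Suc i mod k)} = {x, y}"
    using not_E adj unfolding image_edges_cycle_graph by blast
  have other: "{g j, g (Suc j mod k)} \<in> E" if j: "j < k" "j \<noteq> i" for j
  proof -
    have "{g j, g (Suc j mod k)} \<noteq> {g i, g (Suc i mod k)}"
    proof
      assume "{g j, g (Suc j mod k)} = {g i, g (Suc i mod k)}"
      then have "g ` {j, Suc j mod k} = g ` {i, Suc i mod k}" by simp
      then have eq: "{j, Suc j mod k} = {i, Suc i mod k}"
        by (subst (asm) inj_on_image_eq_iff[OF g]) (use i j k in auto)
      then have "j = Suc i mod k" "i = Suc j mod k"
        using j by (auto simp: doubleton_eq_iff)
      moreover have "Suc l mod k = (if Suc l = k then 0 else Suc l)" if "l < k" for l
        using that by auto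
      ultimately show False
        using i(1) j(1) k by (auto split: if_splits)
    qed
    then show ?thesis using adj[OF j(1)] i by auto
  qed
  define p where "p = map (\<lambda>t. g ((Suc i + t) mod k)) [0..<k]"
  \<comment> \<open>The cycle is cut at its \<open>i\<close>-th edge, so the walk starts at index \<open>i + 1\<close> and ends at \<open>i\<close>.\<close>
  have inj: "inj_on (\<lambda>t. g ((Suc i + t) mod k)) {0..<k}"
  proof (rule inj_onI)
    fix s t assume st: "s \<in> {0..<k}" "t \<in> {0..<k}"
      and "g ((Suc i + s) mod k) = g ((Suc i + t) mod k)"
    then have "(Suc i + s) mod k = (Suc i + t) mod k"
      using k by (intro inj_onD[OF g]) auto
    then show "s = t"
      using st i(1) by (auto simp: mod_if le_mod_geq split: if_splits)
  qed
  have "path_between E (g (Suc i mod k)) p (g i)"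
    unfolding path_between_def
  proof (intro conjI)
    show "p \<noteq> []" using k by (simp add: p_def)
    show "hd p = g (Suc i mod k)" using k by (simp add: p_def hd_map)
    show "last p = g i" using k i by (simp add: p_def last_map)
    show "distinct p" using inj by (simp add: p_def distinct_map)
    show "successively (\<lambda>u v. {u, v} \<in> E) p"
      unfolding successively_conv_nth
    proof (intro allI impI)
      fix t assume "Suc t < length p"
      then have t: "Suc t < k" by (simp add: p_def)
      have "(Suc i + t) mod k \<noteq> i"
      proof
        assume "(Suc i + t) mod k = i"
        then have "g ((Suc i + t) mod k) = g ((Suc i + (k - 1)) mod k)" using i k by simp
        then have "t = k - 1" by (rule inj_onD[OF inj]) (use t in auto)
        then show False using t by simp
      qed
      then show "{p ! t, p ! Suc t} \<in> E"
        using other[of "(Suc i + t) mod k"] t k by (simp add: p_def mod_Suc_eq)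
    qed
  qed
  moreover have "length p = k" by (simp add: p_def)
  ultimately show ?thesis
    using i path_between_rev by (metis doubleton_eq_iff length_rev)
qed

lemma cycle_from_path:
  assumes k: "2 \<le> k" and p: "path_between E x p y" "length p = k"
  shows "(`) (nth p) ` edges (cycle_graph k) \<subseteq> insert {x, y} E"
    and "{x, y} \<in> (`) (nth p) ` edges (cycle_graph k)"
proof -
  have ends: "p ! 0 = x" "p ! (k - 1) = y"
    using p by (auto simp: path_between_def hd_conv_nth last_conv_nth)
  have "{p ! i, p ! (Suc i mod k)} \<in> insert {x, y} E" if "i < k" for i
  proof (cases "Suc i = k")
    case True
    then show ?thesis using ends by auto
  next
    case False
    then show ?thesis
      using that p by (auto simp: path_between_def successively_conv_nth)
  qed
  then show "(`) (nth p) ` edges (cycle_graph k) \<subseteq> insert {x, y} E"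
    unfolding image_edges_cycle_graph by blast
  have "{k - 1, Suc (k - 1) mod k} \<in> edges (cycle_graph k)"
    using k by (auto simp: cycle_graph_def)
  moreover have "nth p ` {k - 1, Suc (k - 1) mod k} = {x, y}"
    using k ends by auto
  ultimately show "{x, y} \<in> (`) (nth p) ` edges (cycle_graph k)" by blast
qed

text \<open>Adding an edge destroys no copy, so the number of copies grows iff some copy contains the new edge.
  Such a copy is a path on \<open>k\<close> vertices between the ends of the edge, closed up by it.\<close>
lemma semisaturated_cycle_iff:
  assumes G: "finite_simple_graph G" and k: "3 \<le> k"
  shows "semisaturated (cycle_graph k) G \<longleftrightarrow>
    (\<forall>x\<in>verts G. \<forall>y\<in>verts G. x \<noteq> y \<longrightarrow> {x, y} \<notin> edges G \<longrightarrow>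
       (\<exists>p. path_between (edges G) x p y \<and> length p = k))"
    (is "_ \<longleftrightarrow> ?R")
proof
  let ?C = "cycle_graph k"
  have C: "finite_simple_graph ?C" using k by (simp add: finite_simple_graph_cycle)
  have G': "finite_simple_graph (add_edge G {x, y})"
    if "x \<in> verts G" "y \<in> verts G" "x \<noteq> y" for x y
    using G that by (auto simp: finite_simple_graph_def add_edge_def)
  {
    assume semi: "semisaturated ?C G"
    show ?R
    proof (intro ballI impI)
      fix x y assume xy: "x \<in> verts G" "y \<in> verts G" "x \<noteq> y" "{x, y} \<notin> edges G"
      then have "{x, y} \<in> compl_edges G" by (simp add: compl_edges_def)
      then have "\<not> copies ?C (add_edge G {x, y}) \<subseteq> copies ?C G"
        using semi card_mono[OF finite_copies[OF G, of ?C]]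
        by (meson linorder_not_le semisaturated_def)
      then obtain S where S: "S \<in> copies ?C (add_edge G {x, y})" "S \<notin> copies ?C G" by blast
      then obtain g where g: "inj_on g (verts ?C)" "S = (g ` verts ?C, (`) g ` edges ?C)"
        "g ` verts ?C \<subseteq> verts G" "(`) g ` edges ?C \<subseteq> insert {x, y} (edges G)"
        using S(1)[unfolded mem_copies_iff[OF C G'[OF xy(1-3)]]]
        by (metis add_edge_def fst_conv snd_conv)
      then have "\<not> (`) g ` edges ?C \<subseteq> edges G"
        using S(2) unfolding mem_copies_iff[OF C G] by blast
      then show "\<exists>p. path_between (edges G) x p y \<and> length p = k"
        using path_from_cycle_through_edge[OF k, of g x y "edges G"] g
        by (simp add: cycle_graph_def)
    qed
  next
    assume R: ?R
    show "semisaturated ?C G"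
      unfolding semisaturated_def
    proof
      fix e assume "e \<in> compl_edges G"
      then obtain x y where xy: "x \<in> verts G" "y \<in> verts G" "x \<noteq> y" "{x, y} \<notin> edges G"
        and e: "e = {x, y}"
        by (auto simp: compl_edges_def card_2_iff)
      then obtain p where p: "path_between (edges G) x p y" "length p = k"
        using R by blast
      have "inj_on (nth p) (verts ?C)"
        using p by (auto simp: path_between_def cycle_graph_def inj_on_def nth_eq_iff_index_eq)
      moreover have "nth p ` verts ?C \<subseteq> verts G"
      proof -
        have "set p \<subseteq> verts G"
          using path_between_verts[OF p(1) xy(3)] G by (auto simp: finite_simple_graph_def)
        then show ?thesis using p(2) by (auto simp: cycle_graph_def)
      qed
      ultimately have new: "(nth p ` verts ?C, (`) (nth p) ` edges ?C) \<in> copies ?C (add_edge G e)"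
        unfolding e mem_copies_iff[OF C G'[OF xy(1-3)]]
        using cycle_from_path(1)[OF _ p] k by (intro exI[of _ "nth p"]) (simp add: add_edge_def)
      moreover have "(nth p ` verts ?C, (`) (nth p) ` edges ?C) \<notin> copies ?C G"
        using cycle_from_path(2)[OF _ p] k xy(4) by (auto simp: copies_def subgraph_def)
      moreover have "copies ?C G \<subseteq> copies ?C (add_edge G e)"
        by (auto simp: copies_def subgraph_def add_edge_def)
      ultimately have "copies ?C G \<subset> copies ?C (add_edge G e)" by blast
      then show "card (copies ?C G) < card (copies ?C (add_edge G e))"
        using finite_copies[OF G'[OF xy(1-3)]] e by (metis psubset_card_mono)
    qed
  }
qed


lemma path_between_ConsD:
  assumes "path_between E x p y" "2 \<le> length p"
  obtains q where "p = x # q" "path_between E (hd q) q y" "{x, hd q} \<in> E" "x \<notin> set q"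
proof -
  obtain q where "p = x # q" "q \<noteq> []"
    using assms by (cases p; cases "tl p") (auto simp: path_between_def)
  with assms that show ?thesis
    by (cases q) (auto simp: path_between_def)
qed

lemma path_leaves_set:
  assumes "path_between E x p y" "x \<in> S" "y \<notin> S"
  shows "\<exists>u v. u \<in> set p \<and> v \<in> set p \<and> {u, v} \<in> E \<and> u \<in> S \<and> v \<notin> S"
  using assms
proof (induction p arbitrary: x)
  case (Cons a q)
  show ?case
  proof (cases "q = []")
    case False
    then have "path_between E (hd q) q y" "{x, hd q} \<in> E" "hd q \<in> set q" "a = x"
      using Cons.prems(1) by (cases q; auto simp: path_between_def)+
    then show ?thesis
      using Cons.IH[of "hd q"] Cons.prems by (cases "hd q \<in> S") auto
  qed (use Cons.prems in \<open>auto simp: path_between_def\<close>)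
qed (simp add: path_between_def)

section \<open>The lower bound\<close>

text \<open>The characterisation by paths serves as the definition here, for a graph that is given by its
  vertices and edges separately.\<close>
locale cycle_semisaturated =
  fixes V :: "'a set" and E :: "'a set set" and k :: nat
  assumes finite_V: "finite V"
    and edge: "\<And>e. e \<in> E \<Longrightarrow> e \<subseteq> V \<and> card e = 2"
    and k: "6 \<le> k" "k \<le> card V"
    and path_exists: "\<And>x y. \<lbrakk>x \<in> V; y \<in> V; x \<noteq> y; {x, y} \<notin> E\<rbrakk>
          \<Longrightarrow> \<exists>p. path_between E x p y \<and> length p = k"
begin

definition nbrs :: "'a \<Rightarrow> 'a set" where
  "nbrs v = {u. {v, u} \<in> E}"

definition pendant :: "'a \<Rightarrow> bool" where
  "pendant x \<longleftrightarrow> card (nbrs x) = 1"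

definition core :: "'a set" where
  "core = {v \<in> V. \<not> pendant v}"

definition has_pendant :: "'a \<Rightarrow> bool" where
  "has_pendant v \<longleftrightarrow> (\<exists>x. pendant x \<and> {v, x} \<in> E)"

definition weight :: "'a \<Rightarrow> nat" where
  "weight v = (if has_pendant v then 2 else 1)"

definition num_edges :: "'a set \<Rightarrow> nat" where
  "num_edges S = card {e \<in> E. e \<subseteq> S}"

lemma finite_E: "finite E"
  using finite_V edge by (intro finite_subset[of E "Pow V"]) auto

lemma edge_neq: "{u, v} \<in> E \<Longrightarrow> u \<noteq> v"
  using edge[of "{u, v}"] by auto

lemma edge_verts: "{u, v} \<in> E \<Longrightarrow> u \<in> V \<and> v \<in> V"
  using edge[of "{u, v}"] by auto

lemma finite_nbrs: "finite (nbrs v)"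
  using edge_verts by (intro finite_subset[OF _ finite_V]) (auto simp: nbrs_def)

lemma edge_sym: "{u, v} \<in> E \<Longrightarrow> {v, u} \<in> E"
  by (simp add: insert_commute)

lemma pendant_nbr_unique:
  assumes "pendant x" "{v, x} \<in> E" "{x, u} \<in> E"
  shows "u = v"
proof -
  obtain w where "nbrs x = {w}"
    using assms(1) by (auto simp: pendant_def card_1_singleton_iff)
  moreover have "u \<in> nbrs x" "v \<in> nbrs x"
    using assms by (simp_all add: nbrs_def edge_sym)
  ultimately show ?thesis by simp
qed

lemma not_pendantI: "\<lbrakk>{z, a} \<in> E; {z, b} \<in> E; a \<noteq> b\<rbrakk> \<Longrightarrow> \<not> pendant z"
  using pendant_nbr_unique[of z b a] edge_sym[of z b] by blast

lemma path_interior_not_pendant: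
  assumes "path_between E x p y" "z \<in> set p" "z \<noteq> x" "z \<noteq> y"
  shows "\<not> pendant z"
proof -
  obtain as bs where p: "p = as @ z # bs"
    using assms(2) by (meson split_list)
  with assms have ne: "as \<noteq> []" "bs \<noteq> []"
    by (auto simp: path_between_def)
  with assms(1) p have "{last as, z} \<in> E" "{z, hd bs} \<in> E"
    by (auto simp: path_between_def successively_append_iff successively_Cons)
  moreover have "last as \<noteq> hd bs"
  proof -
    have "distinct (as @ z # bs)" using assms(1) p by (simp add: path_between_def)
    then show ?thesis using last_in_set[OF ne(1)] hd_in_set[OF ne(2)] by auto
  qed
  ultimately show ?thesis
    using not_pendantI edge_sym by blast
qed

lemma path_in_core:
  assumes "path_between E x p y" "x \<in> core" "y \<in> core" "x \<noteq> y"
  shows "set p \<subseteq> core"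
  using path_interior_not_pendant[OF assms(1)] path_between_verts[OF assms(1,4), of V] edge assms
  by (auto simp: core_def)

text \<open>A pendant vertex makes paths shorter by one: the path from \<open>x\<close> to \<open>u\<close> that semisaturation
  supplies must pass through \<open>v\<close> first. The saved vertex makes up for the weight 2 of \<open>v\<close> when
  such a path is added to a part of the core.\<close>
lemma path_from_pendant_nbr:
  assumes x: "pendant x" "{v, x} \<in> E" and u: "u \<in> V" "u \<noteq> v" "u \<noteq> x"
  shows "\<exists>p. path_between E v p u \<and> length p = k - 1"
proof -
  have "{x, u} \<notin> E"
    using pendant_nbr_unique[OF x] u(2) by blast
  then obtain p where p: "path_between E x p u" "length p = k"
    using path_exists[of x u] u edge_verts[OF x(2)] by blast
  then have "2 \<le> length p" using k by simp
  then obtain q where q: "p = x # q" "path_between E (hd q) q u" "{x, hd q} \<in> E"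
    using path_between_ConsD[OF p(1)] by blast
  then have "hd q = v"
    using pendant_nbr_unique[OF x] by blast
  with q p show ?thesis by auto
qed

text \<open>The only path between two pendant neighbours of \<open>v\<close> passes through \<open>v\<close> alone.\<close>
lemma pendant_unique:
  assumes "pendant x" "{v, x} \<in> E" "pendant y" "{v, y} \<in> E"
  shows "x = y"
proof (rule ccontr)
  assume "x \<noteq> y"
  then obtain p where p: "path_between E v p y" "length p = k - 1"
    using path_from_pendant_nbr[OF assms(1,2), of y] edge_verts[OF assms(4)] edge_neq[OF assms(4)]
    by blast
  then have "2 \<le> length (rev p)" using k by simp
  then obtain q where q: "rev p = y # q" "path_between E (hd q) q v" "{y, hd q} \<in> E"
    using path_between_ConsD[OF path_between_rev[OF p(1)]] by blast
  have "hd q = v"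
    using pendant_nbr_unique[OF assms(3,4)] q(3) by blast
  then have "q = [v]"
    using q(2) by (cases q) (auto simp: path_between_def split: if_splits)
  then have "length (rev p) = 2" using q(1) by simp
  then show False using p(2) k by simp
qed

text \<open>Two pendant vertices that are adjacent would be a component of their own, whereas there are paths to the
  other vertices.\<close>
lemma pendant_nbr_in_core:
  assumes x: "pendant x" "{v, x} \<in> E"
  shows "v \<in> core"
proof -
  have "\<not> V \<subseteq> {v, x}"
    using k card_mono[of "{v, x}" V] by (auto simp: card_insert_if split: if_splits)
  then obtain u where u: "u \<in> V" "u \<noteq> v" "u \<noteq> x" by blast
  obtain p where p: "path_between E v p u" "length p = k - 1"
    using path_from_pendant_nbr[OF x u] by blast
  then have "2 \<le> length p" using k by simp
  then obtain q where q: "p = v # q" "path_between E (hd q) q u" "{v, hd q} \<in> E" "v \<notin> set q"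
    using path_between_ConsD[OF p(1)] by blast
  have hd: "hd q \<in> set p" using q by (auto simp: path_between_def)
  have "hd q \<noteq> x"
  proof
    assume "hd q = x"
    then have "\<not> pendant x"
      using path_interior_not_pendant[OF p(1) hd] u edge_neq[OF x(2)] by auto
    then show False using x(1) by simp
  qed
  then have "\<not> pendant v" using not_pendantI[OF q(3) x(2)] by blast
  then show ?thesis using edge_verts[OF x(2)] by (simp add: core_def)
qed

lemma num_edges_insert:
  assumes "x \<notin> S" "T \<subseteq> S" "\<And>t. t \<in> T \<Longrightarrow> {x, t} \<in> E"
  shows "num_edges S + card T \<le> num_edges (insert x S)"
proof -
  have inj: "inj_on (\<lambda>t. {x, t}) T"
    by (auto simp: inj_on_def doubleton_eq_iff)
  have "finite ((\<lambda>t. {x, t}) ` T)"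
    using assms(3) by (intro finite_subset[OF _ finite_E]) auto
  then have "num_edges S + card T = card ({e \<in> E. e \<subseteq> S} \<union> (\<lambda>t. {x, t}) ` T)"
    unfolding num_edges_def card_image[OF inj, symmetric]
    using assms(1) finite_E by (subst card_Un_disjoint) auto
  also have "\<dots> \<le> num_edges (insert x S)"
    unfolding num_edges_def using assms finite_E by (intro card_mono) auto
  finally show ?thesis .
qed

text \<open>The sequence \<open>xs\<close> leaves \<open>S\<close> at \<open>u\<close> and ends with an edge to a vertex \<open>y\<close> of \<open>S\<close> (an ear) or of
  \<open>xs\<close> itself (a lollipop). Adding its vertices one after the other, each brings the edge to its
  predecessor, and the last one brings the closing edge as well; it is a different edge because
  \<open>y\<close> is not the predecessor of the last vertex. If the sequence enters \<open>S\<close> before its end, then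
  the part before the first vertex of \<open>S\<close> is an ear already. So \<open>xs\<close> may meet \<open>S\<close>
  anywhere but at its first vertex, and only a subset \<open>N\<close> of it is added.\<close>
lemma ear_extension:
  assumes "u \<in> S" "xs \<noteq> []" "hd xs \<notin> S" "distinct (u # xs)"
    "successively (\<lambda>a b. {a, b} \<in> E) (u # xs)"
    "{last xs, y} \<in> E" "y \<in> S \<union> set xs" "y \<noteq> last (butlast (u # xs))"
  shows "\<exists>N\<subseteq>set xs. N \<noteq> {} \<and> N \<inter> S = {} \<and> num_edges S + card N + 1 \<le> num_edges (S \<union> N)"
  using assms
proof (induction xs arbitrary: u S)
  case (Cons x xs)
  have x: "x \<notin> S" "{x, u} \<in> E" using Cons.prems by (auto simp: insert_commute)
  have two: ?case if "w \<in> S" "w \<noteq> u" "{x, w} \<in> E" for w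
    using num_edges_insert[of x S "{u, w}"] that x Cons.prems(1)
    by (intro exI[of _ "{x}"]) auto
  show ?case
  proof (cases xs)
    case Nil
    have "y \<noteq> x" using edge_neq[OF Cons.prems(6)] Nil by auto
    then show ?thesis using two[of y] Cons.prems Nil by auto
  next
    case (Cons x2 rest)
    show ?thesis
    proof (cases "x2 \<in> S")
      case True
      then show ?thesis using two[of x2] Cons.prems Cons by auto
    next
      case False
      have "\<exists>N\<subseteq>set xs. N \<noteq> {} \<and> N \<inter> insert x S = {} \<and>
          num_edges (insert x S) + card N + 1 \<le> num_edges (insert x S \<union> N)"
        by (rule Cons.IH[of x]) (use Cons.prems Cons False in \<open>auto\<close>)
      then obtain N where N: "N \<subseteq> set xs" "N \<inter> insert x S = {}"
        "num_edges (insert x S) + card N + 1 \<le> num_edges (insert x S \<union> N)" by blast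
      have "card (insert x N) = card N + 1"
        using N(1,2) finite_subset[OF N(1)] by (subst card_insert_disjoint) auto
      moreover have "num_edges S + 1 \<le> num_edges (insert x S)"
        using num_edges_insert[of x S "{u}"] x Cons.prems(1) by auto
      ultimately show ?thesis
        using N x by (intro exI[of _ "insert x N"]) auto
    qed
  qed
qed simp

lemma sum_weight_le: "finite A \<Longrightarrow> sum weight A \<le> 2 * card A"
  using sum_bounded_above[of A weight 2] by (simp add: weight_def mult.commute)

text \<open>One step of the construction of the core. Its price, a weight of at most \<open>2 * k - 2\<close> for each surplus edge,
  becomes the denominator in the lower bound.\<close>
definition extendable :: "'a set \<Rightarrow> bool" where
  "extendable S \<longleftrightarrow> (\<exists>N\<subseteq>core. N \<noteq> {} \<and> N \<inter> S = {} \<and> sum weight N \<le> 2 * k - 2 \<and>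
     num_edges S + card N + 1 \<le> num_edges (S \<union> N))"

text \<open>The weight only has to be bounded on a set \<open>A\<close> known in advance, since the set of vertices that are
  really added depends on where the sequence meets \<open>S\<close>.\<close>
lemma extendableI:
  assumes "u \<in> S" "xs \<noteq> []" "hd xs \<notin> S" "distinct (u # xs)"
    "successively (\<lambda>a b. {a, b} \<in> E) (u # xs)"
    "{last xs, y} \<in> E" "y \<in> S \<union> set xs" "y \<noteq> last (butlast (u # xs))"
    "set xs \<subseteq> A" "A \<subseteq> core" "sum weight A \<le> 2 * k - 2"
  shows "extendable S"
proof -
  obtain N where N: "N \<subseteq> set xs" "N \<noteq> {}" "N \<inter> S = {}"
    "num_edges S + card N + 1 \<le> num_edges (S \<union> N)"
    using ear_extension[OF assms(1-8)] by blast
  moreover have "finite A" using assms(10) finite_V by (auto simp: core_def intro: finite_subset)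
  then have "sum weight N \<le> sum weight A"
    using N(1) assms(9) by (intro sum_mono2) auto
  ultimately show ?thesis
    unfolding extendable_def using assms(9-11) by (intro exI[of _ N]) auto
qed

text \<open>The edge \<open>uv\<close> and a path from \<open>v\<close> back to \<open>u\<close> form a cycle, which contains an ear that starts with
  \<open>uv\<close>.\<close>
lemma extendable_cycle:
  assumes u: "u \<in> S" and v: "v \<notin> S" and uv: "{u, v} \<in> E"
    and p: "path_between E v p u" "3 \<le> length p"
    and A: "set p - {u} \<subseteq> A" "A \<subseteq> core" "sum weight A \<le> 2 * k - 2"
  shows "extendable S"
proof -
  obtain xs where xs: "p = xs @ [u]"
    using p by (metis append_butlast_last_id path_between_def)
  have len: "2 \<le> length xs" using p(2) xs by simp
  have d: "distinct (u # xs)" using p(1) xs by (auto simp: path_between_def)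
  have ne: "xs \<noteq> []" "butlast xs \<noteq> []" using len by (cases xs; cases "tl xs"; auto)+
  have hd: "hd xs = v" using p(1) xs ne by (auto simp: path_between_def)
  show ?thesis
  proof (rule extendableI[of u S xs u A])
    show "successively (\<lambda>a b. {a, b} \<in> E) (u # xs)" "{last xs, u} \<in> E"
      using p(1) xs uv hd ne by (auto simp: path_between_def successively_append_iff successively_Cons)
    show "u \<noteq> last (butlast (u # xs))"
      using d ne last_in_set[of "butlast xs"] in_set_butlastD by fastforce
  qed (use u v d hd ne A xs in auto)
qed

text \<open>If \<open>p\<close> avoids \<open>v\<close>, then it is extended by \<open>v\<close> to a path that closes a cycle with \<open>uv\<close>. If \<open>p\<close>
  passes through \<open>v\<close>, then its part from \<open>v\<close> on does so, except when \<open>p\<close> ends with the edge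
  \<open>vu\<close> itself. In the exceptional case the part of \<open>p\<close> from \<open>z\<close> to \<open>v\<close> closes a cycle with the
  edge \<open>vz\<close>, and the edge \<open>uv\<close> followed by this cycle is a lollipop. The edge
  \<open>uv\<close> can be a bridge, so this case cannot be avoided.\<close>
lemma extendable_via_nbr:
  assumes u: "u \<in> S" and v: "v \<notin> S" and uv: "{u, v} \<in> E" and vz: "{v, z} \<in> E"
    and p: "path_between E z p u" "4 \<le> length p"
    and A: "insert v (set p - {u}) \<subseteq> core" "sum weight (insert v (set p - {u})) \<le> 2 * k - 2"
  shows "extendable S"
proof (cases "v \<in> set p")
  case False
  have "path_between E v (v # p) u" using path_between_Cons[OF p(1) vz False] .
  then show ?thesis
    using p(2) A by (intro extendable_cycle[OF u v uv, of "v # p"]) auto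
next
  case True
  then obtain as bs where ab: "p = as @ v # bs" by (meson split_list)
  have vbs: "path_between E v (v # bs) u"
    using path_between_suffix p(1) unfolding ab by metis
  have "bs \<noteq> []" using vbs u v by (auto simp: path_between_def)
  show ?thesis
  proof (cases "2 \<le> length bs")
    case True
    then show ?thesis
      using ab A by (intro extendable_cycle[OF u v uv vbs, of "insert v (set p - {u})"]) auto
  next
    case False
    with \<open>bs \<noteq> []\<close> vbs have bs: "bs = [u]"
      by (cases bs) (auto simp: path_between_def Suc_le_eq)
    have len: "2 \<le> length as" using p(2) ab bs by simp
    then have ne: "as \<noteq> []" "butlast as \<noteq> []" by (cases as; cases "tl as"; auto)+
    have d: "distinct (as @ [v, u])" using p(1) ab bs by (auto simp: path_between_def)
    have "hd as = z" using p(1) ab ne by (auto simp: path_between_def)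
    \<comment> \<open>The lollipop: from \<open>u\<close> to \<open>v\<close>, then along \<open>as\<close> from \<open>z\<close> back to \<open>v\<close>.\<close>
    show ?thesis
    proof (rule extendableI[of u S "v # as" v "insert v (set p - {u})"])
      show "successively (\<lambda>a b. {a, b} \<in> E) (u # v # as)" "{last (v # as), v} \<in> E"
        using p(1) ab bs uv vz \<open>hd as = z\<close> ne
        by (auto simp: path_between_def successively_append_iff successively_Cons)
      show "v \<noteq> last (butlast (u # v # as))"
        using d ne last_in_set[of "butlast as"] in_set_butlastD[of v as] by auto
    qed (use u v d A ab bs in auto)
  qed
qed

text \<open>If \<open>u\<close> or \<open>v\<close> carries a pendant vertex, then a path of \<open>k - 1\<close> vertices between them closes a
  cycle with \<open>uv\<close>. Otherwise a path from another neighbour \<open>z\<close> of \<open>v\<close> to \<open>u\<close> is used. Together with \<open>v\<close> it has up to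
  \<open>k\<close> new vertices, which might weigh \<open>2 * k\<close>. But \<open>v\<close> has weight 1, and
  either \<open>z\<close> has weight 1 too, or \<open>z\<close> carries a pendant vertex and there is a path with one vertex
  less.\<close>
lemma extendable_of_boundary_edge:
  assumes S: "S \<subseteq> core" and u: "u \<in> S" and v: "v \<in> core" "v \<notin> S" and uv: "{u, v} \<in> E"
  shows "extendable S"
proof -
  have uc: "u \<in> core" and "u \<noteq> v" using S u v by auto
  have len: "card (set p - {w}) = length p - 1" if "path_between E w' p w" for w' w p
  proof -
    have "w \<in> set p" "distinct p" using that by (auto simp: path_between_def)
    then show ?thesis by (simp add: distinct_card)
  qed
  show ?thesis
  proof (cases "has_pendant v \<or> has_pendant u")
    case True
    have "\<exists>p. path_between E v p u \<and> length p = k - 1"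
    proof (cases "has_pendant v")
      case True
      then obtain x where x: "pendant x" "{v, x} \<in> E" by (auto simp: has_pendant_def)
      then show ?thesis
        using path_from_pendant_nbr[OF x, of u] uc \<open>u \<noteq> v\<close> by (auto simp: core_def)
    next
      case False
      with True obtain x where x: "pendant x" "{u, x} \<in> E" by (auto simp: has_pendant_def)
      then obtain p where "path_between E u p v" "length p = k - 1"
        using path_from_pendant_nbr[OF x, of v] v \<open>u \<noteq> v\<close> by (auto simp: core_def)
      then show ?thesis using path_between_rev by (metis length_rev)
    qed
    then obtain p where p: "path_between E v p u" "length p = k - 1" by blast
    have "set p \<subseteq> core" using path_in_core[OF p(1)] v uc \<open>u \<noteq> v\<close> by auto
    moreover have "sum weight (set p - {u}) \<le> 2 * k - 2"
      using sum_weight_le[of "set p - {u}"] len[OF p(1)] p(2) by simp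
    ultimately show ?thesis
      using p(2) k by (intro extendable_cycle[OF u v(2) uv p(1), of "set p - {u}"]) auto
  next
    case False
    have "nbrs v \<noteq> {u}" using v by (auto simp: core_def pendant_def)
    moreover have "u \<in> nbrs v" using uv by (simp add: nbrs_def insert_commute)
    ultimately obtain z where z: "z \<in> nbrs v" "z \<noteq> u" by blast
    then have vz: "{v, z} \<in> E" by (simp add: nbrs_def)
    have zc: "z \<in> core"
      using False vz edge_verts[OF vz] by (auto simp: core_def has_pendant_def)
    have "z \<noteq> v" using edge_neq[OF vz] by simp
    have path_core: "insert v (set p - {u}) \<subseteq> core" if "path_between E z p u" for p
      using path_in_core[OF that zc uc z(2)] v by auto
    consider "{z, u} \<in> E" | "has_pendant z" | "{z, u} \<notin> E" "\<not> has_pendant z" by blast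
    then show ?thesis
    proof cases
      case 1
      have "path_between E v [v, z, u] u"
        using 1 vz z \<open>u \<noteq> v\<close> \<open>z \<noteq> v\<close> by (auto simp: path_between_def)
      moreover have "sum weight {v, z} \<le> 2 * k - 2"
        using sum_weight_le[of "{v, z}"] \<open>z \<noteq> v\<close> k by simp
      ultimately show ?thesis
        using v zc by (intro extendable_cycle[OF u v(2) uv, of "[v, z, u]" "{v, z}"]) auto
    next
      case 2
      then obtain x where x: "pendant x" "{z, x} \<in> E" by (auto simp: has_pendant_def)
      then obtain p where p: "path_between E z p u" "length p = k - 1"
        using path_from_pendant_nbr[OF x, of u] uc z(2) by (auto simp: core_def)
      have "sum weight (insert v (set p - {u})) \<le> 2 * card (insert v (set p - {u}))"
        by (rule sum_weight_le) simp
      also have "\<dots> \<le> 2 * (card (set p - {u}) + 1)"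
        by (simp add: card_insert_if)
      also have "\<dots> \<le> 2 * k - 2"
        using len[OF p(1)] p(2) k by simp
      finally show ?thesis
        using p(2) k by (intro extendable_via_nbr[OF u v(2) uv vz p(1) _ path_core[OF p(1)]]) auto
    next
      case 3
      then obtain p where p: "path_between E z p u" "length p = k"
        using path_exists[of z u] zc uc z(2) by (auto simp: core_def)
      let ?B = "set p - {u} - {z} - {v}"
      have "z \<in> set p" using p(1) by (auto simp: path_between_def)
      then have "insert v (set p - {u}) = {v, z} \<union> ?B" using z(2) by auto
      moreover have "sum weight ({v, z} \<union> ?B) = sum weight {v, z} + sum weight ?B"
        by (intro sum.union_disjoint) auto
      moreover have "sum weight {v, z} = 2"
        using 3 False \<open>z \<noteq> v\<close> by (simp add: weight_def)
      moreover have "sum weight ?B \<le> 2 * card ?B" by (rule sum_weight_le) simp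
      moreover have "card ?B \<le> card (set p - {u} - {z})" by (intro card_mono) auto
      moreover have "card (set p - {u} - {z}) = k - 2"
        using len[OF p(1)] p(2) \<open>z \<in> set p\<close> z(2) by (subst card_Diff_singleton) auto
      ultimately have "sum weight (insert v (set p - {u})) \<le> 2 * k - 2" using k by simp
      then show ?thesis
        using p(2) k by (intro extendable_via_nbr[OF u v(2) uv vz p(1) _ path_core[OF p(1)]]) auto
    qed
  qed
qed

text \<open>A path between a vertex of \<open>S\<close> and one of the rest of the core runs inside the core, so it contains
  an edge that leaves \<open>S\<close>.\<close>
lemma extendable_of_proper_subset:
  assumes "S \<subseteq> core" "S \<noteq> {}" "S \<noteq> core"
  shows "extendable S"
proof -
  obtain a b where ab: "a \<in> S" "b \<in> core" "b \<notin> S" using assms by blast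
  have "\<exists>u v. u \<in> S \<and> v \<in> core \<and> v \<notin> S \<and> {u, v} \<in> E"
  proof (cases "{a, b} \<in> E")
    case False
    then obtain p where p: "path_between E a p b"
      using path_exists[of a b] ab assms(1) by (auto simp: core_def)
    moreover have "set p \<subseteq> core" using path_in_core[OF p] ab assms(1) by blast
    ultimately show ?thesis using path_leaves_set[OF p ab(1,3)] by blast
  qed (use ab in blast)
  then show ?thesis using extendable_of_boundary_edge assms(1) by blast
qed

text \<open>The bound holds for a single vertex, whose weight is at most 2. Each extension adds at most
  \<open>2 * k - 2\<close> to the left-hand side and at least that much to the right-hand side. So a maximal set for which it
  holds is the core.\<close>
lemma sum_weight_core_le:
  "int (sum weight core) \<le> 2 + (2 * int k - 2) * (int (num_edges core) + 1 - int (card core))"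
proof -
  let ?bound = "\<lambda>S. 2 + (2 * int k - 2) * (int (num_edges S) + 1 - int (card S))"
  define F where "F = {S. S \<subseteq> core \<and> S \<noteq> {} \<and> int (sum weight S) \<le> ?bound S}"
  have fin: "finite core" using finite_V by (simp add: core_def)
  have "core \<noteq> {}"
  proof -
    obtain v where v: "v \<in> V" using k by fastforce
    show ?thesis
    proof (cases "pendant v")
      case True
      then obtain u where "u \<in> nbrs v" by (auto simp: pendant_def card_1_singleton_iff)
      then have "{u, v} \<in> E" by (simp add: nbrs_def insert_commute)
      then show ?thesis using pendant_nbr_in_core[OF True] by blast
    qed (use v in \<open>auto simp: core_def\<close>)
  qed
  then obtain r where r: "r \<in> core" by blast
  have "{r} \<in> F"
    using r k by (auto simp: F_def weight_def)
  moreover have "finite F" using fin by (auto simp: F_def intro: finite_subset[of _ "Pow core"])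
  ultimately obtain S where S: "S \<in> F" "\<And>T. T \<in> F \<Longrightarrow> S \<subseteq> T \<Longrightarrow> S = T"
    using finite_has_maximal[of F] by blast
  have "S = core"
  proof (rule ccontr)
    assume "S \<noteq> core"
    then have "extendable S"
      using extendable_of_proper_subset S(1) by (auto simp: F_def)
    then obtain N where N: "N \<subseteq> core" "N \<noteq> {}" "N \<inter> S = {}" "sum weight N \<le> 2 * k - 2"
      "num_edges S + card N + 1 \<le> num_edges (S \<union> N)" by (auto simp: extendable_def)
    have fin': "finite S" "finite N"
      using S(1) N(1) fin by (auto simp: F_def intro: finite_subset)
    have "int (sum weight (S \<union> N)) = int (sum weight S) + int (sum weight N)"
      using N(3) fin' by (subst sum.union_disjoint) auto
    also have "\<dots> \<le> ?bound S + (2 * int k - 2)"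
    proof -
      have "int (sum weight N) \<le> 2 * int k - 2" using N(4) k by linarith
      moreover have "int (sum weight S) \<le> ?bound S" using S(1) unfolding F_def by blast
      ultimately show ?thesis by linarith
    qed
    also have "\<dots> = 2 + (2 * int k - 2) * (int (num_edges S) + 1 - int (card S) + 1)"
      by (simp add: algebra_simps)
    also have "\<dots> \<le> ?bound (S \<union> N)"
    proof -
      have "card (S \<union> N) = card S + card N"
        using N(3) fin' by (subst card_Un_disjoint) auto
      then have "int (num_edges S) + 1 - int (card S) + 1
          \<le> int (num_edges (S \<union> N)) + 1 - int (card (S \<union> N))"
        using N(5) by simp
      then show ?thesis using k by (intro add_left_mono mult_left_mono) auto
    qed
    finally have "S \<union> N \<in> F" using S(1) N(1) by (auto simp: F_def)
    then show False using S(2)[of "S \<union> N"] N(2,3) by blast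
  qed
  with S(1) show ?thesis by (simp add: F_def)
qed

text \<open>Passing from the core to the whole graph adds one edge with every pendant vertex, so the number of
  edges minus the number of vertices does not drop. The weight of the core is at least the number of vertices,
  since the pendant vertices sit on different core vertices.\<close>
lemma card_V_le:
  "int (card V) \<le> 2 + (2 * int k - 2) * (int (card E) + 1 - int (card V))"
proof -
  define X where "X = {x \<in> V. pendant x}"
  define nb where "nb x = the_elem (nbrs x)" for x
  have fin: "finite core" "finite X" using finite_V by (auto simp: core_def X_def)
  have V: "card V = card core + card X"
  proof -
    have "card (core \<union> X) = card core + card X"
      using fin by (intro card_Un_disjoint) (auto simp: core_def X_def)
    moreover have "core \<union> X = V" by (auto simp: core_def X_def)
    ultimately show ?thesis by simp
  qed
  have nb: "{nb x, x} \<in> E" if x: "x \<in> X" for x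
  proof -
    have "card (nbrs x) = 1" using x by (simp add: X_def pendant_def)
    then obtain w where w: "nbrs x = {w}" by (rule card_1_singletonE)
    then have "w \<in> nbrs x" by simp
    then have "{w, x} \<in> E" by (simp add: nbrs_def insert_commute)
    then show ?thesis by (simp add: nb_def w)
  qed
  have nb_core: "nb x \<in> core" if "x \<in> X" for x
    using pendant_nbr_in_core nb[OF that] that by (auto simp: X_def)
  have "card X \<le> card {v \<in> core. has_pendant v}"
  proof (rule card_inj_on_le[of nb])
    show "inj_on nb X"
    proof (rule inj_onI)
      fix x y assume xy: "x \<in> X" "y \<in> X" "nb x = nb y"
      then have "{nb x, y} \<in> E" using nb by metis
      moreover have "pendant x" "pendant y" using xy by (simp_all add: X_def)
      ultimately show "x = y" using pendant_unique nb[OF xy(1)] by blast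
    qed
    show "nb ` X \<subseteq> {v \<in> core. has_pendant v}"
      using nb nb_core by (auto simp: X_def has_pendant_def)
  qed (use fin in auto)
  moreover have "sum weight core = card core + card {v \<in> core. has_pendant v}"
  proof -
    have "sum weight core = (\<Sum>v\<in>core. 1 + (if has_pendant v then 1 else 0))"
      by (intro sum.cong) (auto simp: weight_def)
    also have "\<dots> = card core + card {v \<in> core. has_pendant v}"
      using fin unfolding sum.distrib by (simp add: sum.If_cases Int_def)
    finally show ?thesis .
  qed
  ultimately have "card V \<le> sum weight core" using V by simp
  have "num_edges core + card X \<le> card E"
  proof -
    let ?I = "(\<lambda>x. {nb x, x}) ` X"
    have "inj_on (\<lambda>x. {nb x, x}) X"
      using nb_core by (auto simp: inj_on_def doubleton_eq_iff core_def X_def)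
    then have "num_edges core + card X = card ({e \<in> E. e \<subseteq> core} \<union> ?I)"
      unfolding num_edges_def using fin finite_E
      by (subst card_Un_disjoint) (auto simp: card_image core_def X_def)
    also have "\<dots> \<le> card E"
      using nb by (intro card_mono finite_E) auto
    finally show ?thesis .
  qed
  then have "int (num_edges core) + 1 - int (card core) \<le> int (card E) + 1 - int (card V)"
    using V by simp
  then have "(2 * int k - 2) * (int (num_edges core) + 1 - int (card core))
      \<le> (2 * int k - 2) * (int (card E) + 1 - int (card V))"
    using k by (intro mult_left_mono) auto
  then show ?thesis
    using sum_weight_core_le \<open>card V \<le> sum weight core\<close> by linarith
qed

lemma card_E_gt:
  "(1 + 1 / (2 * real k - 2)) * real (card V) - 2 < real (card E)"
proof -
  define c where "c = 2 * real k - 2"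
  have c: "c > 2" using k by (simp add: c_def)
  have "real_of_int (int (card V))
      \<le> real_of_int (2 + (2 * int k - 2) * (int (card E) + 1 - int (card V)))"
    using card_V_le by (simp only: of_int_le_iff)
  then have "real (card V) \<le> 2 + c * (real (card E) + 1 - real (card V))"
    by (simp add: c_def)
  also have "\<dots> < c + c * (real (card E) + 1 - real (card V))"
    using c by simp
  finally have "real (card V) / c < 2 + real (card E) - real (card V)"
    using c by (simp add: field_simps)
  then show ?thesis by (simp add: c_def algebra_simps)
qed

end


section \<open>The upper bound\<close>

text \<open>\<open>Ear t i\<close> is the \<open>i\<close>-th vertex of the \<open>t\<close>-th ear, counted from the centre, and \<open>Pend t i\<close> is the
  pendant vertex on it. Countability transports the graph to the natural numbers at the end.\<close>
datatype vertex = Centre | Rim nat | Ear nat nat | Pend nat nat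

instance vertex :: countable
  by countable_datatype

text \<open>There are \<open>q\<close> ears; the \<open>t\<close>-th one has \<open>m t\<close> vertices, and the first \<open>p t\<close> of them carry pendant
  vertices. Ears of different sizes let the number of vertices be arbitrary. The bound \<open>k - 5\<close>
  comes from the two paths along the ear from the pendant vertex on \<open>Ear t i\<close>, one towards the
  centre and one towards the rim. They have together \<open>m t + 3\<close> vertices outside the wheel, and two
  different ears are connected under the condition that this is at most \<open>k - 2\<close>.\<close>
locale eared_wheel =
  fixes k q :: nat and m p :: "nat \<Rightarrow> nat"
  assumes k: "6 \<le> k"
    and ears: "\<And>t. t < q \<Longrightarrow> 1 \<le> m t \<and> m t \<le> k - 5 \<and> p t \<le> m t"
begin

text \<open>The number of rim vertices; together with the centre the wheel has \<open>k\<close> vertices.\<close>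
definition R :: nat where
  "R = k - 1"

definition hub :: "vertex set" where
  "hub = insert Centre (Rim ` {..<R})"

definition V :: "vertex set" where
  "V = hub \<union> (\<Union>t<q. Ear t ` {..<m t}) \<union> (\<Union>t<q. Pend t ` {..<p t})"

definition E :: "vertex set set" where
  "E = (\<lambda>i. {Centre, Rim i}) ` {..<R} \<union> (\<lambda>i. {Rim i, Rim (Suc i mod R)}) ` {..<R}
     \<union> (\<lambda>t. {Ear t 0, Centre}) ` {..<q}
     \<union> (\<lambda>t. {Ear t (m t - 1), Rim 0}) ` {..<q}
     \<union> (\<Union>t<q. (\<lambda>i. {Ear t i, Ear t (Suc i)}) ` {..<m t - 1})
     \<union> (\<Union>t<q. (\<lambda>i. {Pend t i, Ear t i}) ` {..<p t})"

lemma edge_spoke: "i < R \<Longrightarrow> {Centre, Rim i} \<in> E"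
  and edge_rim: "i < R \<Longrightarrow> {Rim i, Rim (Suc i mod R)} \<in> E"
  and edge_centre: "t < q \<Longrightarrow> {Ear t 0, Centre} \<in> E"
  and edge_last: "t < q \<Longrightarrow> {Ear t (m t - 1), Rim 0} \<in> E"
  and edge_pend: "t < q \<Longrightarrow> i < p t \<Longrightarrow> {Pend t i, Ear t i} \<in> E"
  unfolding E_def by blast+

lemma edge_ear: "t < q \<Longrightarrow> Suc i < m t \<Longrightarrow> {Ear t i, Ear t (Suc i)} \<in> E"
proof -
  assume "t < q" "Suc i < m t"
  then have "t < q" "i < m t - 1" by auto
  then show ?thesis unfolding E_def by blast
qed

lemma R_ge: "5 \<le> R"
  using k by (simp add: R_def)

lemma finite_V: "finite V"
  by (auto simp: V_def hub_def)

lemma edges_wf: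
  assumes "e \<in> E"
  shows "e \<subseteq> V \<and> card e = 2"
proof -
  have rim: "Suc i mod R \<noteq> i" "Suc i mod R < R" if "i < R" for i
    using that R_ge by (cases "Suc i = R"; auto)+
  have R: "0 < R" using R_ge by simp
  have last: "m t - 1 < m t" "0 < m t" if "t < q" for t using ears[OF that] by auto
  have pend: "i < m t" if "t < q" "i < p t" for t i using ears[OF that(1)] that(2) by auto
  have Ear: "Ear t i \<in> V" if "t < q" "i < m t" for t i
    using that unfolding V_def by blast
  have Pend: "Pend t i \<in> V" if "t < q" "i < p t" for t i
    using that unfolding V_def by blast
  have hub: "Centre \<in> V" "i < R \<Longrightarrow> Rim i \<in> V" for i
    unfolding V_def hub_def by blast+
  consider i where "i < R" "e = {Centre, Rim i}" | i where "i < R" "e = {Rim i, Rim (Suc i mod R)}"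
    | t where "t < q" "e = {Ear t 0, Centre}" | t where "t < q" "e = {Ear t (m t - 1), Rim 0}"
    | t i where "t < q" "i < m t - 1" "e = {Ear t i, Ear t (Suc i)}"
    | t i where "t < q" "i < p t" "e = {Pend t i, Ear t i}"
    using assms unfolding E_def by blast
  then show ?thesis
  proof cases
    case (2 i)
    then show ?thesis using hub rim[of i] by auto
  qed (use hub Ear Pend R last pend in auto)
qed

lemma card_V: "card V = k + (\<Sum>t<q. m t + p t)"
proof -
  let ?A = "\<Union>t<q. Ear t ` {..<m t}" and ?B = "\<Union>t<q. Pend t ` {..<p t}"
  have "card (Rim ` {..<R}) = R" by (simp add: card_image inj_on_def)
  then have "card hub = k"
    unfolding hub_def using k by (subst card_insert_disjoint) (auto simp: R_def)
  moreover have "card ?A = (\<Sum>t<q. m t)"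
    by (subst card_UN_disjoint) (auto simp: card_image inj_on_def)
  moreover have "card ?B = (\<Sum>t<q. p t)"
    by (subst card_UN_disjoint) (auto simp: card_image inj_on_def)
  moreover have "card (hub \<union> ?A) = card hub + card ?A"
    by (intro card_Un_disjoint) (auto simp: hub_def)
  moreover have "card (hub \<union> ?A \<union> ?B) = card (hub \<union> ?A) + card ?B"
    by (intro card_Un_disjoint) (auto simp: hub_def)
  ultimately show ?thesis by (simp add: V_def sum.distrib)
qed

text \<open>The wheel has \<open>2 * (k - 1)\<close> edges. A pendant vertex brings one edge, and an ear brings one edge more
  than it has vertices.\<close>
lemma card_E_le: "card E \<le> 2 * (k - 1) + (\<Sum>t<q. m t + p t) + q"
proof -
  have image: "card (f ` {..<n}) \<le> n" for f :: "nat \<Rightarrow> vertex set" and n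
    using card_image_le[of "{..<n}" f] by simp
  have UN: "card (\<Union>t<q. f t ` {..<n t}) \<le> (\<Sum>t<q. n t)" for f :: "nat \<Rightarrow> nat \<Rightarrow> vertex set" and n
    by (rule order_trans[OF card_UN_le sum_mono]) (auto intro: image)
  have "card E \<le> R + R + q + q + (\<Sum>t<q. m t - 1) + (\<Sum>t<q. p t)"
    unfolding E_def
    by (intro order_trans[OF card_Un_le] add_mono image UN)
  moreover have "(\<Sum>t<q. m t) = (\<Sum>t<q. m t - 1) + q"
  proof -
    have "(\<Sum>t<q. m t) = (\<Sum>t<q. (m t - 1) + 1)"
      using ears by (intro sum.cong) force+
    then show ?thesis by (simp only: sum.distrib) simp
  qed
  ultimately show ?thesis by (simp add: R_def sum.distrib)
qed

text \<open>From the centre to a suitable rim vertex, then along the rim to \<open>Rim h\<close>.\<close>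
lemma hub_path:
  assumes h: "h < R" and L: "2 \<le> L" "L \<le> k"
  shows "\<exists>Q. path_between E Centre Q (Rim h) \<and> length Q = L \<and> set Q \<subseteq> hub"
proof -
  \<comment> \<open>The path visits \<open>L - 1\<close> rim vertices and ends in \<open>Rim h\<close>, so it enters the rim \<open>L - 2\<close> places
    earlier; \<open>R\<close> is added to stay within the natural numbers.\<close>
  define c where "c = h + R - (L - 2)"
  define Q where "Q = Centre # map (\<lambda>t. Rim ((c + t) mod R)) [0..<L - 1]"
  have L': "L - 1 \<le> R" using L by (simp add: R_def)
  have R: "0 < R" using R_ge by simp
  have ne: "[0..<L - 1] \<noteq> []" using L by simp
  have inj: "inj_on (\<lambda>t. Rim ((c + t) mod R)) {0..<L - 1}"
  proof (rule inj_onI)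
    fix s t assume st: "s \<in> {0..<L - 1}" "t \<in> {0..<L - 1}"
      and "Rim ((c + s) mod R) = Rim ((c + t) mod R)"
    then have eq: "(c + s) mod R = (c + t) mod R" by simp
    have "s mod R = t mod R"
    proof -
      have "(int c + int s) mod int R = (int c + int t) mod int R"
        using eq by (metis of_nat_add of_nat_mod)
      then have "(int c + int s - int c) mod int R = (int c + int t - int c) mod int R"
        by (rule mod_diff_cong) simp
      then show ?thesis by (simp add: of_nat_mod[symmetric])
    qed
    then show "s = t" using st L' by simp
  qed
  have "path_between E Centre Q (Rim h)"
    unfolding path_between_def
  proof (intro conjI)
    show "last Q = Rim h"
    proof -
      have "c + (L - 2) = h + R" using L L' by (simp add: c_def)
      moreover have "last [0..<L - 1] = L - 2" using L by simp
      ultimately show ?thesis using h ne by (simp add: Q_def last_map)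
    qed
    show "distinct Q" using inj by (auto simp: Q_def distinct_map)
    show "successively (\<lambda>u v. {u, v} \<in> E) Q"
      unfolding successively_conv_nth
    proof (intro allI impI)
      fix t assume t: "Suc t < length Q"
      show "{Q ! t, Q ! Suc t} \<in> E"
      proof (cases t)
        case 0
        then show ?thesis using t R by (auto simp: Q_def intro!: edge_spoke)
      next
        case (Suc s)
        then show ?thesis
          using t R edge_rim[of "(c + s) mod R"] by (simp add: Q_def mod_Suc_eq)
      qed
    qed
  qed (simp_all add: Q_def)
  moreover have "length Q = L" using L by (simp add: Q_def)
  moreover have "set Q \<subseteq> hub" using R by (auto simp: Q_def hub_def)
  ultimately show ?thesis by blast
qed

lemma edge_rim_Suc: "Suc i < R \<Longrightarrow> {Rim i, Rim (Suc i)} \<in> E"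
  using edge_rim[of i] by simp

lemma successively_rim: "b \<le> R \<Longrightarrow> successively (\<lambda>u v. {u, v} \<in> E) (map Rim [a..<b])"
  by (auto simp: successively_conv_nth intro!: edge_rim_Suc)

lemma successively_rim_rev:
  assumes "b \<le> R"
  shows "successively (\<lambda>u v. {u, v} \<in> E) (map Rim (rev [a..<b]))"
  unfolding rev_map[symmetric] successively_rev
  using successively_rim[OF assms, of a] by (simp add: insert_commute)

text \<open>Two rim vertices are joined by a path through the whole wheel: from \<open>x\<close> backwards along the rim to
  the vertex after \<open>y\<close>, through the centre, and from the vertex after \<open>x\<close> forwards to \<open>y\<close>.\<close>
lemma rim_path:
  assumes "x < y" "y < R"
  shows "\<exists>P. path_between E (Rim x) P (Rim y) \<and> length P = k"
proof -
  let ?A = "map Rim (rev [0..<Suc x])" and ?B = "map Rim (rev [Suc y..<R])"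
    and ?C = "map Rim [Suc x..<Suc y]"
  have A: "path_between E (Rim x) ?A (Rim 0)"
    using assms successively_rim_rev[of "Suc x" 0]
    by (auto simp: path_between_def last_map last_rev distinct_map inj_on_def hd_map)
  have C: "path_between E (Rim (Suc x)) ?C (Rim y)"
    using assms successively_rim[of "Suc y" "Suc x"]
    by (simp add: path_between_def last_map distinct_map inj_on_def hd_map del: upt_Suc)
  have CC: "path_between E Centre (Centre # ?C) (Rim y)"
    using assms by (intro path_between_Cons[OF C] edge_spoke) auto
  have disj: "set ?A \<inter> set (?B @ Centre # ?C) = {}" using assms by auto
  have "path_between E (Rim x) (?A @ ?B @ Centre # ?C) (Rim y)"
  proof (cases "Suc y = R")
    case True
    have "{Rim 0, Centre} \<in> E" using edge_spoke[of 0] assms by (simp add: insert_commute)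
    then show ?thesis
      using path_between_join[OF A CC] True disj by simp
  next
    case False
    then have y: "Suc y < R" using assms by simp
    have "path_between E (Rim (Suc y)) (map Rim [Suc y..<R]) (Rim (R - 1))"
      using y successively_rim[of R "Suc y"]
      by (simp add: path_between_def last_map distinct_map inj_on_def hd_map)
    then have B: "path_between E (Rim (R - 1)) ?B (Rim (Suc y))"
      unfolding rev_map[symmetric] by (rule path_between_rev)
    have "{Rim (Suc y), Centre} \<in> E"
      using edge_spoke[OF y] by (simp add: insert_commute)
    moreover have "set ?B \<inter> set (Centre # ?C) = {}" by (auto simp del: upt_Suc)
    ultimately have "path_between E (Rim (R - 1)) (?B @ Centre # ?C) (Rim y)"
      by (rule path_between_join[OF B CC])
    moreover have "{Rim 0, Rim (R - 1)} \<in> E"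
      using edge_rim[of "R - 1"] y by (auto simp: insert_commute)
    ultimately show ?thesis
      using path_between_join[OF A _ _ disj] by blast
  qed
  moreover have "length (?A @ ?B @ Centre # ?C) = k"
    using assms k by (simp add: R_def)
  ultimately show ?thesis by blast
qed

text \<open>A uniform name for the vertices outside the wheel, with a flag for the pendant ones, so that the
  arguments below need not be repeated for the four combinations of types.\<close>
definition outer :: "nat \<Rightarrow> nat \<Rightarrow> bool \<Rightarrow> vertex" where
  "outer t i b = (if b then Pend t i else Ear t i)"

definition is_outer :: "nat \<Rightarrow> nat \<Rightarrow> bool \<Rightarrow> bool" where
  "is_outer t i b \<longleftrightarrow> t < q \<and> i < m t \<and> (b \<longrightarrow> i < p t)"

lemma V_cases:
  assumes "x \<in> V"
  obtains "x = Centre" | h where "h < R" "x = Rim h" | t i b where "is_outer t i b" "x = outer t i b"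
proof -
  have "\<exists>b. is_outer t i b \<and> x = outer t i b" if "x = Ear t i" "t < q" "i < m t" for t i
    using that by (intro exI[of _ False]) (auto simp: is_outer_def outer_def)
  moreover have "\<exists>b. is_outer t i b \<and> x = outer t i b" if "x = Pend t i" "t < q" "i < p t" for t i
    using that ears[OF that(2)] by (intro exI[of _ True]) (auto simp: is_outer_def outer_def)
  ultimately show ?thesis
    using assms that unfolding V_def hub_def
    by (elim UnE insertE UN_E imageE) blast+
qed

lemma outer_path:
  assumes "is_outer t i b" "path_between E (Ear t i) P y" "Pend t i \<notin> set P"
  shows "\<exists>P'. path_between E (outer t i b) P' y \<and> length P' = length P + of_bool b \<and>
    set P' \<subseteq> insert (outer t i b) (set P)"
proof (cases b)
  case True
  then have "path_between E (Pend t i) (Pend t i # P) y"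
    using assms by (intro path_between_Cons[OF assms(2)] edge_pend) (auto simp: is_outer_def)
  then show ?thesis using True by (intro exI[of _ "Pend t i # P"]) (auto simp: outer_def)
qed (use assms in \<open>auto simp: outer_def\<close>)

lemma successively_ear:
  "t < q \<Longrightarrow> b \<le> m t \<Longrightarrow> successively (\<lambda>u v. {u, v} \<in> E) (map (Ear t) [a..<b])"
  by (auto simp: successively_conv_nth intro!: edge_ear)

lemma path_to_centre:
  assumes "is_outer t i b"
  shows "\<exists>P. path_between E (outer t i b) P (Ear t 0) \<and> length P = Suc i + of_bool b \<and>
    set P \<subseteq> insert (outer t i b) (Ear t ` {..i})"
proof -
  let ?P = "rev (map (Ear t) [0..<Suc i])"
  have t: "t < q" "Suc i \<le> m t" using assms by (auto simp: is_outer_def)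
  then have "path_between E (Ear t 0) (map (Ear t) [0..<Suc i]) (Ear t i)"
    using successively_ear[OF t, of 0]
    by (simp add: path_between_def distinct_map inj_on_def hd_map last_map del: upt_Suc)
  then have "path_between E (Ear t i) ?P (Ear t 0)" by (rule path_between_rev)
  then have "\<exists>P'. path_between E (outer t i b) P' (Ear t 0) \<and>
      length P' = length ?P + of_bool b \<and> set P' \<subseteq> insert (outer t i b) (set ?P)"
    by (rule outer_path[OF assms]) auto
  moreover have "set ?P = Ear t ` {..i}" by auto
  ultimately show ?thesis by simp
qed

lemma path_to_rim:
  assumes "is_outer t i b"
  shows "\<exists>P. path_between E (outer t i b) P (Ear t (m t - 1)) \<and>
    length P = m t - i + of_bool b \<and> set P \<subseteq> insert (outer t i b) (Ear t ` {i..})"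
proof -
  let ?P = "map (Ear t) [i..<m t]"
  have t: "t < q" "i < m t" using assms by (auto simp: is_outer_def)
  then have "path_between E (Ear t i) ?P (Ear t (m t - 1))"
    using successively_ear[of t "m t" i]
    by (simp add: path_between_def distinct_map inj_on_def hd_map last_map)
  then have "\<exists>P'. path_between E (outer t i b) P' (Ear t (m t - 1)) \<and>
      length P' = length ?P + of_bool b \<and> set P' \<subseteq> insert (outer t i b) (set ?P)"
    by (rule outer_path[OF assms]) auto
  then obtain P' where P': "path_between E (outer t i b) P' (Ear t (m t - 1))"
    "length P' = length ?P + of_bool b" "set P' \<subseteq> insert (outer t i b) (set ?P)" by blast
  moreover have "set ?P \<subseteq> Ear t ` {i..}" by auto
  ultimately show ?thesis by (intro exI[of _ P'] conjI) (blast | simp)+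
qed

definition linked :: "vertex \<Rightarrow> vertex \<Rightarrow> bool" where
  "linked x y \<longleftrightarrow> (\<exists>P. path_between E x P y \<and> length P = k)"

lemma linked_sym: "linked x y \<Longrightarrow> linked y x"
  unfolding linked_def using path_between_rev by (metis length_rev)

lemma linked_outer_rim:
  assumes w: "is_outer t i b" and h: "h < R"
  shows "linked (outer t i b) (Rim h)"
proof -
  obtain P where P: "path_between E (outer t i b) P (Ear t 0)" "length P = Suc i + of_bool b"
    "set P \<subseteq> insert (outer t i b) (Ear t ` {..i})"
    using path_to_centre[OF w] by blast
  have t: "t < q" "i < k - 5" using w ears by (fastforce simp: is_outer_def)+
  then have len: "length P + 2 \<le> k" using P(2) by (cases b) auto
  then obtain Q where Q: "path_between E Centre Q (Rim h)" "length Q = k - length P" "set Q \<subseteq> hub"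
    using hub_path[OF h, of "k - length P"] by force
  have "set P \<inter> set Q = {}" using P(3) Q(3) by (auto simp: hub_def outer_def split: if_splits)
  then have "path_between E (outer t i b) (P @ Q) (Rim h)"
    using path_between_join[OF P(1) Q(1)] edge_centre[OF t(1)] by blast
  then show ?thesis using len Q(2) by (auto simp: linked_def)
qed

lemma linked_outer_centre:
  assumes w: "is_outer t i b"
  shows "linked (outer t i b) Centre"
proof -
  obtain P where P: "path_between E (outer t i b) P (Ear t (m t - 1))"
    "length P = m t - i + of_bool b" "set P \<subseteq> insert (outer t i b) (Ear t ` {i..})"
    using path_to_rim[OF w] by blast
  have t: "t < q" "m t \<le> k - 5" using w ears by (auto simp: is_outer_def)
  then have len: "length P + 2 \<le> k" using P(2) k by (cases b) auto
  then obtain Q where Q: "path_between E Centre Q (Rim 0)" "length Q = k - length P" "set Q \<subseteq> hub"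
    using hub_path[of 0 "k - length P"] R_ge by force
  have "set P \<inter> set (rev Q) = {}" using P(3) Q(3) by (auto simp: hub_def outer_def split: if_splits)
  then have "path_between E (outer t i b) (P @ rev Q) Centre"
    using path_between_join[OF P(1) path_between_rev[OF Q(1)]] edge_last[OF t(1)] by blast
  then show ?thesis using len Q(2) by (auto simp: linked_def)
qed

text \<open>The path leaves the ear of the first vertex through the centre and enters that of the second one
  through the rim; the wheel fills in whatever is missing from \<open>k\<close> vertices, at least two of them. Within
  the same ear this is a path if the first vertex is the one closer to the centre.\<close>
lemma linked_outer_outer:
  assumes w: "is_outer t i b" and w': "is_outer t' i' b'"
    and disj: "t \<noteq> t' \<or> i < i'"
    and short: "(Suc i + of_bool b) + (m t' - i' + of_bool b') + 2 \<le> k"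
  shows "linked (outer t i b) (outer t' i' b')"
proof -
  obtain P where P: "path_between E (outer t i b) P (Ear t 0)" "length P = Suc i + of_bool b"
    "set P \<subseteq> insert (outer t i b) (Ear t ` {..i})"
    using path_to_centre[OF w] by blast
  obtain P' where P': "path_between E (outer t' i' b') P' (Ear t' (m t' - 1))"
    "length P' = m t' - i' + of_bool b'" "set P' \<subseteq> insert (outer t' i' b') (Ear t' ` {i'..})"
    using path_to_rim[OF w'] by blast
  let ?L = "k - length P - length P'"
  obtain Q where Q: "path_between E Centre Q (Rim 0)" "length Q = ?L" "set Q \<subseteq> hub"
  proof -
    have "2 \<le> ?L" "?L \<le> k" "0 < R" using R_ge short P(2) P'(2) by auto
    then show ?thesis using hub_path[of 0 ?L] that by blast
  qed
  have t: "t < q" "t' < q" using w w' by (auto simp: is_outer_def)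
  let ?S = "insert (outer t i b) (Ear t ` {..i})" and ?S' = "insert (outer t' i' b') (Ear t' ` {i'..})"
  have "?S \<inter> ?S' = {}" "hub \<inter> ?S = {}" "hub \<inter> ?S' = {}"
    using disj by (auto simp: hub_def outer_def)
  with P(3) P'(3) obtain S S' where "set P \<subseteq> S" "set P' \<subseteq> S'"
    "S \<inter> S' = {}" "hub \<inter> S = {}" "hub \<inter> S' = {}" by metis
  then have "set Q \<inter> set (rev P') = {}" "set P \<inter> set (Q @ rev P') = {}"
    using Q(3) unfolding set_append set_rev by blast+
  moreover have "{Rim 0, Ear t' (m t' - 1)} \<in> E"
    using edge_last[OF t(2)] by (simp add: insert_commute)
  ultimately have "path_between E (outer t i b) (P @ Q @ rev P') (outer t' i' b')"
    using path_between_join[OF Q(1) path_between_rev[OF P'(1)]] path_between_join[OF P(1)]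
      edge_centre[OF t(1)] by blast
  moreover have "length (P @ Q @ rev P') = k"
    using Q(2) short P(2) P'(2) by simp
  ultimately show ?thesis unfolding linked_def by blast
qed

text \<open>The two paths along the ear from a vertex \<open>w\<close> outside the wheel have together at most \<open>k - 2\<close>
  vertices, \<open>w\<close> being counted twice. So of the two connections between \<open>w\<close> and a vertex \<open>w'\<close> of another ear (out
  through the centre and in through the rim, or the other way round), the shorter one has at
  most \<open>k - 2\<close> vertices outside the wheel.\<close>
lemma linked_outer:
  assumes w: "is_outer t i b" and w': "is_outer t' i' b'"
    and neq: "outer t i b \<noteq> outer t' i' b'" and nonadj: "{outer t i b, outer t' i' b'} \<notin> E"
  shows "linked (outer t i b) (outer t' i' b')"
proof -
  have t: "m t \<le> k - 5" "i < m t" "m t' \<le> k - 5" "i' < m t'"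
    using w w' ears by (auto simp: is_outer_def)
  show ?thesis
  proof (cases "t = t'")
    case True
    have "i \<noteq> i'"
    proof
      assume "i = i'"
      then have "{outer t i b, outer t' i' b'} = {Pend t i, Ear t i}" "b \<or> b'"
        using True neq by (auto simp: outer_def split: if_splits)
      then show False
        using edge_pend[of t i] w w' True \<open>i = i'\<close> nonadj by (auto simp: is_outer_def)
    qed
    then consider "i < i'" | "i' < i" by linarith
    then show ?thesis
    proof cases
      case 1
      then show ?thesis using t True k by (intro linked_outer_outer[OF w w']) auto
    next
      case 2
      then show ?thesis using t True k by (intro linked_sym[OF linked_outer_outer[OF w' w]]) auto
    qed
  next
    case False
    let ?a = "Suc i + of_bool b" and ?a' = "Suc i' + of_bool b'"
    let ?c = "m t - i + of_bool b" and ?c' = "m t' - i' + of_bool b'"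
    have "?a + ?c + 2 \<le> k" "?a' + ?c' + 2 \<le> k" using t k by auto
    then have "?a + ?c' + 2 \<le> k \<or> ?a' + ?c + 2 \<le> k" by linarith
    then show ?thesis
    proof
      assume "?a + ?c' + 2 \<le> k"
      then show ?thesis using False by (intro linked_outer_outer[OF w w']) auto
    next
      assume "?a' + ?c + 2 \<le> k"
      then show ?thesis using False by (intro linked_sym[OF linked_outer_outer[OF w' w]]) auto
    qed
  qed
qed

lemma linked_nonadjacent:
  assumes x: "x \<in> V" and y: "y \<in> V" and xy: "x \<noteq> y" "{x, y} \<notin> E"
  shows "linked x y"
proof -
  have rim: "linked (Rim g) (Rim h)" if "g < R" "h < R" "g \<noteq> h" for g h
  proof (cases "g < h")
    case True
    then show ?thesis using rim_path that unfolding linked_def by blast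
  next
    case False
    then have "linked (Rim h) (Rim g)" using rim_path[of h g] that unfolding linked_def by auto
    then show ?thesis by (rule linked_sym)
  qed
  show ?thesis
    using x
  proof (cases rule: V_cases)
    case 1
    show ?thesis
      using y
    proof (cases rule: V_cases)
      case (2 h)
      then show ?thesis using 1 xy edge_spoke by auto
    next
      case (3 t i b)
      then show ?thesis using 1 linked_outer_centre linked_sym by blast
    qed (use 1 xy in auto)
  next
    case x: (2 g)
    show ?thesis
      using y
    proof (cases rule: V_cases)
      case 1
      then show ?thesis using x xy edge_spoke[of g] by (auto simp: insert_commute)
    next
      case (2 h)
      then show ?thesis using x xy rim by auto
    next
      case (3 t i b)
      then show ?thesis using x linked_outer_rim linked_sym by blast
    qed
  next
    case x: (3 t i b)
    show ?thesis
      using y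
    proof (cases rule: V_cases)
      case 1
      then show ?thesis using x linked_outer_centre by blast
    next
      case (2 h)
      then show ?thesis using x linked_outer_rim by blast
    next
      case (3 t' i' b')
      then show ?thesis using x xy linked_outer by auto
    qed
  qed
qed

definition nat_graph :: "nat ugraph" where
  "nat_graph = (to_nat ` V, (`) to_nat ` E)"

lemma nat_graph_simple: "finite_simple_graph nat_graph"
  using finite_V edges_wf inj_on_subset[OF inj_to_nat]
  by (auto simp: finite_simple_graph_def nat_graph_def card_image)

lemma card_nat_graph: "card (verts nat_graph) = card V" "card (edges nat_graph) \<le> card E"
proof -
  have "finite E" using finite_V edges_wf by (intro finite_subset[of E "Pow V"]) auto
  then show "card (edges nat_graph) \<le> card E" by (simp add: nat_graph_def card_image_le)
qed (simp add: nat_graph_def card_image inj_on_subset[OF inj_to_nat])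

lemma nat_graph_semisaturated: "semisaturated (cycle_graph k) nat_graph"
proof -
  have "\<exists>P. path_between (edges nat_graph) (to_nat x) P (to_nat y) \<and> length P = k"
    if xy: "x \<in> V" "y \<in> V" "x \<noteq> y" "{to_nat x, to_nat y} \<notin> edges nat_graph" for x y
  proof -
    have "{x, y} \<notin> E"
      using xy(4) imageI[of "{x, y}" E "(`) to_nat"] by (auto simp: nat_graph_def)
    then obtain P where "path_between E x P y" "length P = k"
      using linked_nonadjacent[OF xy(1-3)] unfolding linked_def by blast
    then show ?thesis
      using path_between_map[OF _ inj_to_nat] by (metis length_map nat_graph_def snd_conv)
  qed
  then show ?thesis
    using k by (subst semisaturated_cycle_iff[OF nat_graph_simple]) (auto simp: nat_graph_def)
qed

end

text \<open>As many ears as possible are full, with \<open>M\<close> vertices and \<open>M\<close> pendant ones. One more ear takes up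
  what is left, if anything, with half of it (rounded up) on the ear and the other half pendant.\<close>
lemma ear_sizes_exist:
  fixes M N :: nat
  assumes "1 \<le> M"
  shows "\<exists>q m p. (\<forall>t<q. 1 \<le> m t \<and> m t \<le> M \<and> p t \<le> m t) \<and>
    (\<Sum>t<q. m t + p t) = N \<and> q * (2 * M) < N + 2 * M"
proof (induction N rule: less_induct)
  case (less N)
  consider "N = 0" | "0 < N" "N \<le> 2 * M" | "2 * M < N" by linarith
  then show ?case
  proof cases
    case 1
    then show ?thesis using assms by (intro exI[of _ 0]) auto
  next
    case 2
    have "(N + 1) div 2 + N div 2 = N" by presburger
    then show ?thesis
      using 2 by (intro exI[of _ 1] exI[of _ "\<lambda>_. (N + 1) div 2"] exI[of _ "\<lambda>_. N div 2"]) auto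
  next
    case 3
    then obtain q m p where IH: "\<forall>t<q. 1 \<le> m t \<and> m t \<le> M \<and> p t \<le> m t"
      "(\<Sum>t<q. m t + p t) = N - 2 * M" "q * (2 * M) < N - 2 * M + 2 * M"
      using less.IH[of "N - 2 * M"] assms by auto
    show ?thesis
    proof (intro exI conjI)
      show "\<forall>t<Suc q. 1 \<le> (m(q := M)) t \<and> (m(q := M)) t \<le> M \<and> (p(q := M)) t \<le> (m(q := M)) t"
        using IH(1) assms by (auto simp: less_Suc_eq)
      show "(\<Sum>t<Suc q. (m(q := M)) t + (p(q := M)) t) = N"
        using IH(2) 3 by simp
      show "Suc q * (2 * M) < N + 2 * M"
        using IH(3) 3 by simp
    qed
  qed
qed

lemma semisaturated_graph_exists:
  assumes k: "6 \<le> k" and n: "k \<le> n"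
  shows "\<exists>G :: nat ugraph. finite_simple_graph G \<and> card (verts G) = n \<and>
    semisaturated (cycle_graph k) G \<and>
    real (card (edges G)) < (1 + 1 / (2 * real k - 10)) * real n + real k - 1"
proof -
  obtain q m p where ears: "\<forall>t<q. 1 \<le> m t \<and> m t \<le> k - 5 \<and> p t \<le> m t"
    and sum: "(\<Sum>t<q. m t + p t) = n - k"
    and q: "q * (2 * (k - 5)) < n - k + 2 * (k - 5)"
  proof -
    have "1 \<le> k - 5" using k by simp
    from ear_sizes_exist[OF this, of "n - k"] show ?thesis using that by blast
  qed
  interpret eared_wheel k q m p
    using ears k by unfold_locales auto
  define c where "c = 2 * real k - 10"
  have c: "0 < c" using k by (simp add: c_def)
  have "real (q * (2 * (k - 5))) < real (n - k + 2 * (k - 5))" using q by (simp only: of_nat_less_iff)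
  then have "real q * c < real n - real k + c"
    using k n by (simp add: c_def of_nat_diff)
  also have "\<dots> < real n + c" using k by simp
  finally have "real q < real n / c + 1" using c by (simp add: field_simps)
  moreover have "card (edges nat_graph) \<le> 2 * (k - 1) + (n - k) + q"
    using card_nat_graph(2) card_E_le sum by simp
  then have "real (card (edges nat_graph)) \<le> real k - 2 + real n + real q"
    using k n by linarith
  ultimately have "real (card (edges nat_graph)) < (1 + 1 / c) * real n + real k - 1"
    by (simp add: algebra_simps)
  moreover have "card (verts nat_graph) = n"
    using card_nat_graph(1) card_V sum n by simp
  ultimately show ?thesis
    using nat_graph_simple nat_graph_semisaturated unfolding c_def by blast
qed

section \<open>The semisaturation number\<close>

theorem theorem4p2:
  fixes n k :: nat
  assumes "6 \<le> k" and "k \<le> n"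
  shows "(1 + 1 / (2 * real k - 2)) * real n - 2 < real (ssat n (cycle_graph k)) \<and>
         real (ssat n (cycle_graph k)) < (1 + 1 / (2 * real k - 10)) * real n + real k - 1"
proof
  let ?P = "\<lambda>m. \<exists>G :: nat ugraph. finite_simple_graph G \<and> card (verts G) = n \<and>
        semisaturated (cycle_graph k) G \<and> card (edges G) = m"
  obtain G :: "nat ugraph" where G: "finite_simple_graph G" "card (verts G) = n"
    "semisaturated (cycle_graph k) G"
    "real (card (edges G)) < (1 + 1 / (2 * real k - 10)) * real n + real k - 1"
    using semisaturated_graph_exists[OF assms] by blast
  then have P: "?P (card (edges G))" by blast
  then have "ssat n (cycle_graph k) \<le> card (edges G)"
    unfolding ssat_def by (rule Least_le)
  then show "real (ssat n (cycle_graph k)) < (1 + 1 / (2 * real k - 10)) * real n + real k - 1"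
    using G(4) by linarith
  have "?P (ssat n (cycle_graph k))"
    unfolding ssat_def using P by (rule LeastI)
  then obtain H :: "nat ugraph" where H: "finite_simple_graph H" "card (verts H) = n"
    "semisaturated (cycle_graph k) H" "card (edges H) = ssat n (cycle_graph k)" by blast
  interpret H: cycle_semisaturated "verts H" "edges H" k
  proof
    show "\<exists>p. path_between (edges H) x p y \<and> length p = k"
      if "x \<in> verts H" "y \<in> verts H" "x \<noteq> y" "{x, y} \<notin> edges H" for x y
      using H(3) semisaturated_cycle_iff[OF H(1), of k] assms that by auto
  qed (use H assms in \<open>auto simp: finite_simple_graph_def\<close>)
  show "(1 + 1 / (2 * real k - 2)) * real n - 2 < real (ssat n (cycle_graph k))"
    using H.card_E_gt H by simp
qed

end
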